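(* Let $T$ be a tree of order $n\ge 4$ having exactly $s$ non-pendent (internal) vertices, and let $P_n$ be the path on $n$ vertices. Then $LE(T)\ge LE(P_n)$ holds in each of the following cases: (i) $s=1$ and $n\ge 9$; (ii) $s=2$ and $n\ge 12$; (iii) $s=3$ and $n\ge 14$; (iv) $s=4$ and $n\ge 17$; (v) $s=5$ and $n\ge 20$; (vi) $s=6$ and $n\ge 23$; (vii) $s=7$ and $n\ge 25$; (viii) $s\le \frac{9n}{25}-2$ (with no further restriction on $n$).
   Context: For a simple graph $G$ with $n$ vertices and $m$ edges, let $L(G)=D(G)-A(G)$ be its Laplacian matrix ($D(G)$ the diagonal matrix of vertex degrees, $A(G)$ the adjacency matrix), with eigenvalues $\mu_1(G)\ge\mu_2(G)\ge\dots\ge\mu_n(G)=0$ counted with multiplicity. The average degree is $\overline{d}(G)=\frac{2m}{n}$. The Laplacian energy is $LE(G)=\sum_{i=1}^{n}\left|\mu_i(G)-\overline{d}(G)\right|$. A vertex is pendent if its degree is $1$, and non-pendent (internal) otherwise. *)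

theory Defs
  imports
    "Graph_Theory.Graph_Theory"
    "Jordan_Normal_Form.Char_Poly"
    "HOL-Combinatorics.Permutations"
begin

section \<open>Simple graphs and trees\<close>

text \<open>
  A finite simple graph is a \<open>pair_graph\<close>: a finite loop-free digraph with a symmetric arc
  relation, each undirected edge \<open>{u, v}\<close> being the two arcs \<open>(u, v)\<close> and \<open>(v, u)\<close>.
  Hence the degree of a vertex is its out-degree, while edges are counted as unordered pairs.
\<close>

definition num_edges :: "'a pair_pre_digraph \<Rightarrow> nat" where
  "num_edges G = card ((\<lambda>(u, v). {u, v}) ` parcs G)"

definition degree_of :: "'a pair_pre_digraph \<Rightarrow> 'a \<Rightarrow> nat" where
  "degree_of G v = out_degree (with_proj G) v"

text \<open>
  The constants \<open>forest\<close> and \<open>tree\<close> of the digraph library are unsuitable for undirected graphs: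
  there every edge traversed back and forth is a directed cycle of length 2. Cycles
  of an undirected simple graph have at least three edges.
\<close>

definition is_tree :: "'a pair_pre_digraph \<Rightarrow> bool" where
  "is_tree G \<longleftrightarrow> pair_graph G \<and> connected (with_proj G) \<and>
     \<not> (\<exists>p. pre_digraph.cycle (with_proj G) p \<and> 3 \<le> length p)"

definition non_pendent :: "'a pair_pre_digraph \<Rightarrow> 'a set" where
  "non_pendent G = {v \<in> pverts G. degree_of G v \<noteq> 1}"

definition path_graph :: "nat \<Rightarrow> nat pair_pre_digraph" where
  "path_graph n = \<lparr> pverts = {..<n},
     parcs = {(i, j). i < n \<and> j < n \<and> (j = Suc i \<or> i = Suc j)} \<rparr>"


section \<open>Laplacian matrix and Laplacian energy\<close>

text \<open>Rows and columns are indexed along a list \<open>vs\<close> enumerating the vertices.\<close>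

definition degree_matrix :: "'a pair_pre_digraph \<Rightarrow> 'a list \<Rightarrow> real mat" where
  "degree_matrix G vs = mat (length vs) (length vs)
     (\<lambda>(i, j). if i = j then real (degree_of G (vs ! i)) else 0)"

definition adjacency_matrix :: "'a pair_pre_digraph \<Rightarrow> 'a list \<Rightarrow> real mat" where
  "adjacency_matrix G vs = mat (length vs) (length vs)
     (\<lambda>(i, j). if (vs ! i, vs ! j) \<in> parcs G then 1 else 0)"

definition laplacian_matrix :: "'a pair_pre_digraph \<Rightarrow> 'a list \<Rightarrow> real mat" where
  "laplacian_matrix G vs = degree_matrix G vs - adjacency_matrix G vs"

definition vertex_enum :: "'a pair_pre_digraph \<Rightarrow> 'a list" where
  "vertex_enum G = (SOME vs. distinct vs \<and> set vs = pverts G)"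

text \<open>
  The multiset of eigenvalues, with (algebraic) multiplicity. It does not depend on the chosen
  enumeration, and no eigenvalue is lost by working over the reals; see
  \<open>laplacian_spectrum_eq\<close> and \<open>size_laplacian_spectrum\<close> below.
\<close>

definition laplacian_spectrum :: "'a pair_pre_digraph \<Rightarrow> real multiset" where
  "laplacian_spectrum G = proots (char_poly (laplacian_matrix G (vertex_enum G)))"

definition average_degree :: "'a pair_pre_digraph \<Rightarrow> real" where
  "average_degree G = 2 * real (num_edges G) / real (card (pverts G))"

definition laplacian_energy :: "'a pair_pre_digraph \<Rightarrow> real" where
  "laplacian_energy G = (\<Sum>\<mu>\<in>#laplacian_spectrum G. \<bar>\<mu> - average_degree G\<bar>)"


section \<open>Well-definedness\<close>

lemma laplacian_matrix_carrier:
  "laplacian_matrix G vs \<in> carrier_mat (length vs) (length vs)"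
  by (auto simp: laplacian_matrix_def degree_matrix_def adjacency_matrix_def minus_carrier_mat)

lemma vertex_enum:
  assumes "finite (pverts G)"
  shows "distinct (vertex_enum G)" "set (vertex_enum G) = pverts G"
proof -
  have "distinct (vertex_enum G) \<and> set (vertex_enum G) = pverts G"
    unfolding vertex_enum_def by (rule someI_ex) (metis assms finite_distinct_list)
  then show "distinct (vertex_enum G)" "set (vertex_enum G) = pverts G" by auto
qed

lemma laplacian_matrix_index:
  assumes "i < length vs" "j < length vs"
  shows "laplacian_matrix G vs $$ (i, j) =
    (if i = j then real (degree_of G (vs ! i)) else 0) -
    (if (vs ! i, vs ! j) \<in> parcs G then 1 else 0)"
  using assms by (simp add: laplacian_matrix_def degree_matrix_def adjacency_matrix_def)

lemma char_poly_permute: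
  fixes A B :: "real mat"
  assumes A: "A \<in> carrier_mat n n" and B: "B \<in> carrier_mat n n" and p: "p permutes {..<n}"
    and AB: "\<And>i j. i < n \<Longrightarrow> j < n \<Longrightarrow> B $$ (i, j) = A $$ (p i, p j)"
  shows "char_poly B = char_poly A"
proof -
  let ?P = "mat n n (\<lambda>(i, j). if j = p i then 1 else 0 :: real)"
  let ?Q = "mat n n (\<lambda>(i, j). if i = p j then 1 else 0 :: real)"
  have pn: "p i < n" if "i < n" for i using p that permutes_in_image by fastforce
  have inj: "p i = p j \<longleftrightarrow> i = j" for i j using permutes_inj[OF p] by (auto dest: injD)
  have PQ: "?P * ?Q = 1\<^sub>m n"
    by (rule eq_matI)
      (auto simp: scalar_prod_def pn inj if_distrib[of "\<lambda>x. x * _"] sum.delta cong: if_cong)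
  have QP: "?Q * ?P = 1\<^sub>m n" by (rule mat_mult_left_right_inverse[OF _ _ PQ]) auto
  have PA: "?P * A = mat n n (\<lambda>(i, j). A $$ (p i, j))"
    using A by (intro eq_matI)
      (auto simp: scalar_prod_def pn if_distrib[of "\<lambda>x. x * _"] sum.delta cong: if_cong)
  have "B = ?P * A * ?Q"
    unfolding PA using B
    by (intro eq_matI)
      (auto simp: scalar_prod_def pn AB if_distrib[of "\<lambda>x. _ * x"] sum.delta cong: if_cong)
  then have "similar_mat_wit B A ?P ?Q"
    using A B PQ QP by (intro similar_mat_witI) auto
  then show ?thesis using char_poly_similar unfolding similar_mat_def by blast
qed

lemma laplacian_spectrum_eq:
  assumes "finite (pverts G)" "distinct vs" "set vs = pverts G"
  shows "laplacian_spectrum G = proots (char_poly (laplacian_matrix G vs))"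
proof -
  let ?w = "vertex_enum G"
  have "mset ?w = mset vs" 
    using vertex_enum[OF assms(1)] assms by (metis set_eq_iff_mset_eq_distinct)
  then obtain p where p: "p permutes {..<length vs}" "permute_list p vs = ?w"
    by (metis mset_eq_permutation)
  have len: "length ?w = length vs" using \<open>mset ?w = mset vs\<close> by (metis size_mset)
  have nth: "?w ! i = vs ! p i" if "i < length vs" for i
    using p that permute_list_nth by metis
  have pn: "p i < length vs" if "i < length vs" for i
    using p(1) that permutes_in_image by fastforce
  have inj: "p i = p j \<longleftrightarrow> i = j" for i j using permutes_inj[OF p(1)] by (auto dest: injD)
  have "char_poly (laplacian_matrix G ?w) = char_poly (laplacian_matrix G vs)"
    using laplacian_matrix_carrier[of G ?w] laplacian_matrix_carrier[of G vs] p(1)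
    by (intro char_poly_permute[where n = "length vs" and p = p])
      (auto simp: len nth pn inj laplacian_matrix_index)
  then show ?thesis by (simp add: laplacian_spectrum_def)
qed

lemma symmetric_mat_char_poly_splits:
  fixes A :: "real mat"
  assumes A: "A \<in> carrier_mat n n"
    and sym: "\<And>i j. i < n \<Longrightarrow> j < n \<Longrightarrow> A $$ (i, j) = A $$ (j, i)"
  shows "\<exists>as. char_poly A = (\<Prod>a\<leftarrow>as. [:- a, 1:]) \<and> length as = n"
proof -
  let ?B = "map_mat complex_of_real A"
  interpret m: map_poly_comm_ring_hom complex_of_real ..
  have B: "?B \<in> carrier_mat n n" using A by simp
  obtain as where as: "char_poly ?B = (\<Prod>a\<leftarrow>as. [:- a, 1:])" "length as = n"
    using char_poly_factorized[OF B] by auto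
  have real: "a = complex_of_real (Re a)" if a: "a \<in> set as" for a
  proof -
    have "poly (char_poly ?B) a = 0" unfolding as using a
      by (induction as) auto
    then have "eigenvalue ?B a" using eigenvalue_root_char_poly[OF B] by simp
    then obtain v where v: "v \<in> carrier_vec n" "v \<noteq> 0\<^sub>v n" "?B *\<^sub>v v = a \<cdot>\<^sub>v v"
      unfolding eigenvalue_def eigenvector_def using B by auto
    define q where "q = (\<Sum>i<n. cnj (v $ i) * v $ i)"
    have row: "(\<Sum>j<n. complex_of_real (A $$ (i, j)) * v $ j) = a * v $ i" if "i < n" for i
    proof -
      have "(?B *\<^sub>v v) $ i = (a \<cdot>\<^sub>v v) $ i" using v by simp
      then show ?thesis using A v(1) that
        by (simp add: scalar_prod_def atLeast0LessThan)
    qed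
    have q1: "a * q = (\<Sum>i<n. \<Sum>j<n. of_real (A $$ (i, j)) * (cnj (v $ i) * v $ j))"
      unfolding q_def sum_distrib_left
    proof (rule sum.cong[OF refl])
      fix i assume "i \<in> {..<n}"
      then have i: "i < n" by simp
      have "a * (cnj (v $ i) * v $ i) = cnj (v $ i) * (a * v $ i)" by simp
      also have "\<dots> = cnj (v $ i) * (\<Sum>j<n. of_real (A $$ (i, j)) * v $ j)"
        using row[OF i] by simp
      finally show "a * (cnj (v $ i) * v $ i) =
          (\<Sum>j<n. of_real (A $$ (i, j)) * (cnj (v $ i) * v $ j))"
        by (simp add: sum_distrib_left mult.left_commute)
    qed
    have "cnj (a * q) = (\<Sum>i<n. \<Sum>j<n. of_real (A $$ (i, j)) * (v $ i * cnj (v $ j)))"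
      unfolding q1 by simp
    also have "\<dots> = (\<Sum>j<n. \<Sum>i<n. of_real (A $$ (i, j)) * (v $ i * cnj (v $ j)))"
      by (rule sum.swap)
    also have "\<dots> = a * q"
      unfolding q1 by (intro sum.cong refl) (simp add: sym mult.commute)
    finally have "cnj a * cnj q = a * q" by simp
    have qr: "q = of_real (\<Sum>i<n. (cmod (v $ i))\<^sup>2)"
      unfolding q_def of_real_sum
      by (intro sum.cong refl) (metis complex_norm_square mult.commute of_real_power)
    obtain i where i: "i < n" "v $ i \<noteq> 0"
      using v(1,2) by (metis carrier_vecD eq_vecI index_zero_vec)
    have "(\<Sum>i<n. (cmod (v $ i))\<^sup>2) > 0"
      by (rule sum_pos2[of _ i]) (use i in auto)
    then have "q \<noteq> 0" "cnj q = q" unfolding qr by (simp_all only: of_real_eq_0_iff complex_cnj_complex_of_real)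
    then have "cnj a = a" using \<open>cnj a * cnj q = a * q\<close> by simp
    then show ?thesis by (simp add: complex_eq_iff)
  qed
  have "map_poly complex_of_real (char_poly A) = char_poly ?B"
    by (rule of_real_hom.char_poly_hom[OF A, symmetric])
  also have "\<dots> = (\<Prod>a\<leftarrow>as. map_poly complex_of_real [:- Re a, 1:])"
    unfolding as
  proof (intro arg_cong[where f = prod_list] map_cong refl)
    fix a assume "a \<in> set as"
    then have "[:- a, 1:] = [:- complex_of_real (Re a), 1:]" using real by metis
    then show "[:- a, 1:] = map_poly complex_of_real [:- Re a, 1:]"
      by (simp add: map_poly_pCons)
  qed
  also have "\<dots> = map_poly complex_of_real (\<Prod>a\<leftarrow>map Re as. [:- a, 1:])"
    by (induction as) (simp_all only: list.map prod_list.Nil prod_list.Cons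
        m.hom_mult m.hom_one)
  finally have "char_poly A = (\<Prod>a\<leftarrow>map Re as. [:- a, 1:])"
    by (simp add: poly_eq_iff coeff_map_poly)
  then show ?thesis using as(2) by (intro exI[of _ "map Re as"]) simp
qed

lemma size_laplacian_spectrum:
  assumes "pair_graph G"
  shows "size (laplacian_spectrum G) = card (pverts G)"
proof -
  interpret pair_graph G by (rule assms)
  let ?w = "vertex_enum G"
  have "(u, v) \<in> parcs G \<longleftrightarrow> (v, u) \<in> parcs G" for u v
    using pair_sym_arcs by (auto simp: symmetric_def dest: symD)
  then have "\<exists>as. char_poly (laplacian_matrix G ?w) = (\<Prod>a\<leftarrow>as. [:- a, 1:]) \<and> length as = length ?w"
    by (intro symmetric_mat_char_poly_splits laplacian_matrix_carrier)
      (auto simp: laplacian_matrix_index)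
  then obtain as where as: "char_poly (laplacian_matrix G ?w) = (\<Prod>a\<leftarrow>as. [:- a, 1:])"
    "length as = length ?w" by auto
  have "size (proots (\<Prod>a\<leftarrow>as. [:- a, 1:])) = length as" for as :: "real list"
    by (induction as)
      (simp_all add: proots_mult prod_list_zero_iff image_iff del: mult_pCons_left)
  then have "size (laplacian_spectrum G) = length ?w"
    unfolding laplacian_spectrum_def as by (simp add: as(2))
  also have "\<dots> = card (pverts G)"
    using vertex_enum[OF pair_finite_verts] by (metis distinct_card)
  finally show ?thesis .
qed

end

theory Submission
  imports Defs
begin

text \<open>
  By Schur's theorem the eigenvalues of a symmetric matrix majorise its diagonal, so
  \<open>LE(T)\<close> is at least the sum of the deviations of the vertex degrees from the average degree
  \<open>d\<close>. Since these deviations sum to zero, the \<open>n - s\<close> pendent vertices alone give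
  \<open>LE(T) \<ge> 2 (n - s) (d - 1)\<close>, with \<open>d \<ge> 2 - 2/n\<close> by connectedness.
  For the path the eigenvalues are \<open>2 - 2 cos (\<pi> j / n)\<close>; summing the cosines gives
  \<open>LE(P\<^sub>n) \<le> 2 / sin (\<pi> / 2n) \<le> 4n/\<pi> + \<pi>/n\<close>. As \<open>\<pi> \<ge> 25/8\<close>, the two bounds compare as
  required once \<open>s \<le> 9n/25 - 2\<close>, and each of the cases (i)-(vii) satisfies this inequality.
\<close>

section \<open>Diagonalization of real symmetric matrices\<close>

text \<open>The reflection in the hyperplane orthogonal to \<open>w\<close> = e_0 - \<open>u\<close>
  exchanges e_0 and \<open>u\<close>. It serves as an orthogonal change of basis that turns a unit
  eigenvector into a basis vector.\<close>

lemma householder_exists: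
  fixes u :: "real vec"
  assumes u: "u \<in> carrier_vec (Suc n)" and norm: "u \<bullet> u = 1"
  obtains H where "H \<in> carrier_mat (Suc n) (Suc n)" "H\<^sup>T = H" "H * H = 1\<^sub>m (Suc n)" "col H 0 = u"
proof -
  let ?N = "Suc n"
  define w where "w i = (if i = 0 then 1 else 0) - u $ i" for i
  \<comment> \<open>This is the usual factor 2 / |w|^2, since |w|^2 = 2 (1 - \<open>u $ 0\<close>).
    When \<open>u\<close> is e_0, division by zero makes it 0 and \<open>H\<close> the identity,
    which still has first column \<open>u\<close>.\<close>
  define c where "c = 1 / (1 - u $ 0)"
  define H where "H = mat ?N ?N (\<lambda>(i, j). (if i = j then 1 else 0) - c * w i * w j)"
  have uu: "(\<Sum>i<?N. u $ i * u $ i) = 1"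
    using norm u by (simp add: scalar_prod_def atLeast0LessThan)
  have "(\<Sum>i<?N. w i * w i) = (\<Sum>i<?N. (if i = 0 then 1 - 2 * u $ 0 else 0) + u $ i * u $ i)"
    by (rule sum.cong) (auto simp: w_def algebra_simps)
  also have "\<dots> = 2 * (1 - u $ 0)"
    by (simp only: sum.distrib uu) simp
  finally have ww: "(\<Sum>i<?N. w i * w i) = 2 * (1 - u $ 0)" .
  have cww: "c * c * (\<Sum>i<?N. w i * w i) = 2 * c"
    unfolding ww c_def by (simp add: divide_simps)
  have H: "H \<in> carrier_mat ?N ?N" "H\<^sup>T = H"
    unfolding H_def by (auto intro!: eq_matI simp: mult_ac)
  have HH: "H * H = 1\<^sub>m ?N"
  proof (rule eq_matI)
    fix i j assume "i < dim_row (1\<^sub>m ?N :: real mat)" "j < dim_col (1\<^sub>m ?N :: real mat)"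
    then have ij: "i < ?N" "j < ?N" by auto
    have "(H * H) $$ (i, j) =
        (\<Sum>k<?N. ((if i = k then 1 else 0) - c * w i * w k) * ((if k = j then 1 else 0) - c * w k * w j))"
      using ij by (simp add: H_def scalar_prod_def atLeast0LessThan del: sum.lessThan_Suc)
    also have "\<dots> = (\<Sum>k<?N. (if k = i then (if i = j then 1 else 0) - c * w i * w j else 0)
        - (if k = j then c * w i * w j else 0) + c * c * w i * w j * (w k * w k))"
      by (rule sum.cong) (auto simp: algebra_simps)
    also have "\<dots> = (if i = j then 1 else 0) - 2 * c * (w i * w j) + c * c * w i * w j * (\<Sum>k<?N. w k * w k)"
      using ij by (simp only: sum.distrib sum_subtractf sum_distrib_left[symmetric]) simp
    also have "\<dots> = (if i = j then 1 else 0) + (c * c * (\<Sum>k<?N. w k * w k) - 2 * c) * (w i * w j)"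
      by (simp add: algebra_simps del: sum.lessThan_Suc)
    also have "\<dots> = 1\<^sub>m ?N $$ (i, j)"
      unfolding cww using ij by simp
    finally show "(H * H) $$ (i, j) = 1\<^sub>m ?N $$ (i, j)" .
  qed (use H in auto)
  \<comment> \<open>Column 0 of \<open>H\<close> is e_0 minus \<open>c * w 0\<close> times
    \<open>w\<close>, so this identity makes it e_0 - \<open>w\<close> = \<open>u\<close>. If
    \<open>u $ 0 = 1\<close>, then \<open>w\<close> has length 0; otherwise
    \<open>c * w 0 = 1\<close>.\<close>
  have "w i = c * w 0 * w i" if "i < ?N" for i
  proof (cases "u $ 0 = 1")
    case True
    then have "(\<Sum>i<?N. w i * w i) = 0" using ww by simp
    then have "w i = 0" using that by (subst (asm) sum_nonneg_eq_0_iff) auto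
    then show ?thesis by simp
  qed (simp add: c_def w_def)
  then have "col H 0 = u"
    using u by (intro eq_vecI) (auto simp: H_def w_def algebra_simps)
  with H HH show ?thesis by (intro that)
qed

text \<open>Deflation: the factorization supplies a real eigenvalue, a reflection moves a unit
  eigenvector to e_0, and symmetry then splits off a 1 x 1 block. The remaining symmetric block has
  the remaining linear factors.\<close>

lemma real_symmetric_diagonalization:
  fixes A :: "real mat"
  assumes "A \<in> carrier_mat n n" "A\<^sup>T = A" "char_poly A = (\<Prod>a\<leftarrow>as. [:- a, 1:])" "length as = n"
  obtains U where "U \<in> carrier_mat n n" "U * U\<^sup>T = 1\<^sub>m n" "A = U * mat_diag n (nth as) * U\<^sup>T"
  using assms
proof (induction n arbitrary: A as thesis)
  case 0
  show ?case by (rule 0(1)[of "1\<^sub>m 0"]) (use 0 in \<open>auto intro!: eq_matI\<close>)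
next
  case (Suc m)
  let ?N = "Suc m"
  obtain a bs where as: "as = a # bs" and lbs: "length bs = m" using Suc.prems(5) by (cases as) auto
  note A = Suc.prems(2) and sym = Suc.prems(3)
  have "eigenvalue A a"
    unfolding eigenvalue_root_char_poly[OF A] Suc.prems(4) as by simp
  then obtain v where v: "v \<in> carrier_vec ?N" "v \<noteq> 0\<^sub>v ?N" "A *\<^sub>v v = a \<cdot>\<^sub>v v"
    unfolding eigenvalue_def eigenvector_def using A by auto
  have vv: "v \<bullet> v > 0"
  proof -
    obtain i where "i < ?N" "v $ i \<noteq> 0"
      using v(1,2) by (metis carrier_vecD eq_vecI index_zero_vec)
    then have "(\<Sum>i\<in>{0..<?N}. v $ i * v $ i) > 0"
      by (intro sum_pos2[of _ i]) (auto simp: zero_less_mult_iff)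
    then show ?thesis using v(1) by (simp add: scalar_prod_def)
  qed
  define u where "u = (1 / sqrt (v \<bullet> v)) \<cdot>\<^sub>v v"
  have u: "u \<in> carrier_vec ?N" using v by (simp add: u_def)
  have uu: "u \<bullet> u = 1" using v vv by (simp add: u_def real_sqrt_mult_self)
  have Au: "A *\<^sub>v u = a \<cdot>\<^sub>v u"
    using A v by (auto simp: u_def mult_mat_vec smult_smult_assoc mult.commute)
  obtain H where H: "H \<in> carrier_mat ?N ?N" "H\<^sup>T = H" "H * H = 1\<^sub>m ?N" "col H 0 = u"
    using householder_exists[OF u uu] .
  define B where "B = H * A * H"
  have B: "B \<in> carrier_mat ?N ?N" using H A by (simp add: B_def)
  have HBH: "H * B * H = A"
  proof -
    have "H * B * H = (H * H) * A * (H * H)"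
      using H(1) A by (simp add: B_def assoc_mult_mat[of _ ?N ?N _ ?N _ ?N])
    then show ?thesis using H A by simp
  qed
  have Bsym: "B\<^sup>T = B"
    unfolding B_def using H A sym by (simp add: transpose_mult[of _ ?N ?N _ ?N] assoc_mult_mat[of _ ?N ?N _ ?N _ ?N])
  \<comment> \<open>\<open>H\<close> is an involution with first column \<open>u\<close>, so it
    sends the eigenvector \<open>u\<close> back to e_0.\<close>
  have colB: "col B 0 = a \<cdot>\<^sub>v unit_vec ?N 0"
  proof -
    have "col B 0 = H * A *\<^sub>v col H 0"
      unfolding B_def using H A by (subst col_mult2[of _ ?N ?N _ ?N]) auto
    also have "\<dots> = H *\<^sub>v (a \<cdot>\<^sub>v u)"
      using H A u Au by (simp add: assoc_mult_mat_vec[of _ ?N ?N _ ?N])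
    also have "\<dots> = a \<cdot>\<^sub>v (H *\<^sub>v col H 0)"
      using H u by (simp add: mult_mat_vec)
    also have "H *\<^sub>v col H 0 = col (H * H) 0"
      using H(1) by (subst col_mult2[of _ ?N ?N _ ?N]) auto
    finally show ?thesis unfolding H(3) by simp
  qed
  have B0: "B $$ (i, 0) = (if i = 0 then a else 0)" if "i < ?N" for i
    using arg_cong[OF colB, of "\<lambda>x. x $ i"] that B by auto
  have B0': "B $$ (0, i) = (if i = 0 then a else 0)" if "i < ?N" for i
    using B0[OF that] that B arg_cong[OF Bsym, of "\<lambda>x. x $$ (i, 0)"] by auto
  define C where "C = mat m m (\<lambda>(i, j). B $$ (Suc i, Suc j))"
  let ?a = "mat 1 1 (\<lambda>_. a)"
  have C: "C \<in> carrier_mat m m" by (simp add: C_def)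
  have Bblock: "B = four_block_mat ?a (0\<^sub>m 1 m) (0\<^sub>m m 1) C"
    using B B0 B0' by (intro eq_matI) (auto simp: C_def)
  have "similar_mat_wit A B H H"
    using H A B HBH by (intro similar_mat_witI[where n = "?N"]) auto
  then have "char_poly A = char_poly B"
    using char_poly_similar unfolding similar_mat_def by blast
  also have "\<dots> = [:- a, 1:] * char_poly C"
    unfolding Bblock
    by (subst char_poly_four_block_zeros_col[OF _ _ C]) (auto simp: char_poly_defs det_def)
  finally have "char_poly C = (\<Prod>a\<leftarrow>bs. [:- a, 1:])"
    unfolding Suc.prems(4) as by (simp del: mult_pCons_left)
  moreover have "C\<^sup>T = C"
  proof (rule eq_matI)
    fix i j assume "i < dim_row C" "j < dim_col C"
    then have "i < m" "j < m" by (auto simp: C_def)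
    then show "C\<^sup>T $$ (i, j) = C $$ (i, j)"
      using B arg_cong[OF Bsym, of "\<lambda>x. x $$ (Suc i, Suc j)"] by (simp add: C_def)
  qed (auto simp: C_def)
  ultimately obtain V where V: "V \<in> carrier_mat m m" "V * V\<^sup>T = 1\<^sub>m m" "C = V * mat_diag m (nth bs) * V\<^sup>T"
    using Suc.IH[OF _ C _ _ lbs] by blast
  \<comment> \<open>The diagonalization of \<open>C\<close> is lifted by bordering \<open>V\<close>
    with a 1; composing with \<open>H\<close> then gives the required orthogonal matrix.\<close>
  let ?F = "\<lambda>X Y. four_block_mat X (0\<^sub>m 1 m) (0\<^sub>m m 1) Y"
  let ?W = "?F (1\<^sub>m 1) V"
  let ?D = "mat_diag ?N (nth as)"
  have W: "?W \<in> carrier_mat ?N ?N" using four_block_carrier_mat[OF one_carrier_mat V(1), of 1] by simp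
  have WT: "?W\<^sup>T = ?F (1\<^sub>m 1) (V\<^sup>T)"
    using V(1) by (subst transpose_four_block_mat[of _ 1 1 _ m _ m]) auto
  have WW: "?W * ?W\<^sup>T = 1\<^sub>m ?N"
    unfolding WT using V by (subst mult_four_block_mat[of _ 1 1 _ m _ m _ _ 1 _ m]) auto
  have D: "?D = ?F ?a (mat_diag m (nth bs))"
    unfolding as by (intro eq_matI) (auto simp: mat_diag_def nth_Cons split: nat.splits)
  have Dc: "?D \<in> carrier_mat ?N ?N" by simp
  have dc: "mat_diag m (nth bs) \<in> carrier_mat m m" by simp
  have B_eq: "B = ?W * ?D * ?W\<^sup>T"
    unfolding WT D Bblock V(3) using V(1) dc
    by (simp add: mult_four_block_mat[of _ 1 1 _ m _ m _ _ 1 _ m] del: four_block_one_mat mat_diag_dim)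
  show ?case
  proof (rule Suc.prems(1))
    let ?U = "H * ?W"
    show "?U \<in> carrier_mat ?N ?N" using H W by simp
    have UT: "?U\<^sup>T = ?W\<^sup>T * H"
      using H W by (subst transpose_mult[of _ ?N ?N _ ?N]) auto
    have WT': "?W\<^sup>T \<in> carrier_mat ?N ?N" using W by simp
    have "?U * ?U\<^sup>T = H * (?W * ?W\<^sup>T) * H"
      unfolding UT using H(1) W WT' by (simp add: assoc_mult_mat[of _ ?N ?N _ ?N _ ?N])
    then show "?U * ?U\<^sup>T = 1\<^sub>m ?N" unfolding WW using H by simp
    have "?U * ?D * ?U\<^sup>T = H * (?W * ?D * ?W\<^sup>T) * H"
      unfolding UT using H(1) W WT' Dc by (simp add: mult_carrier_mat[of _ ?N ?N _ ?N] assoc_mult_mat[of _ ?N ?N _ ?N _ ?N])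
    then show "A = ?U * ?D * ?U\<^sup>T" unfolding B_eq[symmetric] HBH by simp
  qed
qed

text \<open>Each diagonal entry is an average of the eigenvalues with weights
  \<open>U $$ (i, k)\<close> squared, and these weights are doubly stochastic. Row sums 1 move
  \<open>c\<close> inside the average, the triangle inequality applies, and column sums 1 collapse
  the swapped double sum.\<close>

lemma sum_abs_diag_le_sum_abs_eigenvalues:
  fixes A :: "real mat"
  assumes "A \<in> carrier_mat n n" "A\<^sup>T = A" "char_poly A = (\<Prod>a\<leftarrow>as. [:- a, 1:])" "length as = n"
  shows "(\<Sum>i<n. \<bar>A $$ (i, i) - c\<bar>) \<le> (\<Sum>a\<leftarrow>as. \<bar>a - c\<bar>)"
proof -
  obtain U where U: "U \<in> carrier_mat n n" "U * U\<^sup>T = 1\<^sub>m n" "A = U * mat_diag n (nth as) * U\<^sup>T"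
    using real_symmetric_diagonalization[OF assms] .
  let ?p = "\<lambda>i k. (U $$ (i, k))\<^sup>2"
  have U2: "U\<^sup>T * U = 1\<^sub>m n"
    using U by (intro mat_mult_left_right_inverse[OF _ _ U(2)]) auto
  have rows: "(\<Sum>k<n. ?p i k) = 1" if "i < n" for i
    using arg_cong[OF U(2), of "\<lambda>X. X $$ (i, i)"] that U(1)
    by (simp add: scalar_prod_def atLeast0LessThan power2_eq_square)
  have cols: "(\<Sum>i<n. ?p i k) = 1" if "k < n" for k
    using arg_cong[OF U2, of "\<lambda>X. X $$ (k, k)"] that U(1)
    by (simp add: scalar_prod_def atLeast0LessThan power2_eq_square)
  have diag: "A $$ (i, i) = (\<Sum>k<n. ?p i k * as ! k)" if "i < n" for i
    unfolding U(3) mat_diag_mult_right[OF U(1)] using that U(1)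
    by (simp add: scalar_prod_def atLeast0LessThan power2_eq_square mult_ac)
  have "(\<Sum>i<n. \<bar>A $$ (i, i) - c\<bar>) = (\<Sum>i<n. \<bar>\<Sum>k<n. ?p i k * (as ! k - c)\<bar>)"
    by (intro sum.cong refl arg_cong[where f = abs])
      (simp add: diag rows right_diff_distrib sum_subtractf sum_distrib_right[symmetric])
  also have "\<dots> \<le> (\<Sum>i<n. \<Sum>k<n. ?p i k * \<bar>as ! k - c\<bar>)"
    by (intro sum_mono order_trans[OF sum_abs]) (simp add: abs_mult)
  also have "\<dots> = (\<Sum>k<n. (\<Sum>i<n. ?p i k) * \<bar>as ! k - c\<bar>)"
    by (subst sum.swap) (simp add: sum_distrib_right)
  also have "\<dots> = (\<Sum>k<n. \<bar>as ! k - c\<bar>)" by (simp add: cols)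
  also have "\<dots> = (\<Sum>a\<leftarrow>as. \<bar>a - c\<bar>)"
    using assms(4) by (simp add: sum_list_sum_nth atLeast0LessThan)
  finally show ?thesis .
qed

section \<open>Edges, degrees and the Laplacian energy\<close>

lemma degree_of_eq: "degree_of G v = card {e \<in> parcs G. fst e = v}"
  by (simp add: degree_of_def out_degree_def out_arcs_def)

lemma (in pair_graph) parcs_sym: "(u, v) \<in> parcs G \<longleftrightarrow> (v, u) \<in> parcs G"
  using pair_sym_arcs by (auto simp: symmetric_def dest: symD)

text \<open>Each edge comes from exactly two arcs, which differ because there are no loops.\<close>

lemma (in pair_graph) card_parcs: "card (parcs G) = 2 * num_edges G"
proof -
  let ?e = "\<lambda>(u, v). {u, v}"
  have fibre: "card {a \<in> parcs G. ?e a = E} = 2" if E: "E \<in> ?e ` parcs G" for E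
  proof -
    obtain u v where uv: "(u, v) \<in> parcs G" "E = {u, v}" using E by auto
    then have "u \<noteq> v" using pair_no_loops by fastforce
    moreover have "{a \<in> parcs G. ?e a = E} = {(u, v), (v, u)}"
      using uv parcs_sym by (auto simp: doubleton_eq_iff)
    ultimately show ?thesis by simp
  qed
  have "card (parcs G) = (\<Sum>E\<in>?e ` parcs G. card {a \<in> parcs G. ?e a = E})"
    using sum.image_gen[OF pair_finite_arcs, of "\<lambda>_. 1 :: nat" ?e] by simp
  also have "\<dots> = 2 * num_edges G"
    using fibre by (simp add: num_edges_def)
  finally show ?thesis .
qed

text \<open>Handshake lemma, by grouping the arcs by their tails; a vertex that is no tail has
  degree 0.\<close>

lemma (in pair_graph) sum_degree_of: "(\<Sum>v\<in>pverts G. degree_of G v) = 2 * num_edges G"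
proof -
  have "card (parcs G) = (\<Sum>v\<in>fst ` parcs G. card {e \<in> parcs G. fst e = v})"
    using sum.image_gen[OF pair_finite_arcs, of "\<lambda>_. 1 :: nat" fst] by simp
  also have "\<dots> = (\<Sum>v\<in>pverts G. degree_of G v)"
    unfolding degree_of_eq
    by (intro sum.mono_neutral_left)
      (auto simp: pair_finite_verts in_arcsD1 card_eq_0_iff image_iff Bex_def)
  finally show ?thesis using card_parcs by simp
qed

section \<open>Consequences of connectedness\<close>

text \<open>A vertex set that no arc leaves contains everything reachable from it, hence all
  vertices by strong connectedness.\<close>

lemma (in pair_graph) connected_boundary_arc:
  assumes "connected (with_proj G)" "S \<subset> pverts G" "S \<noteq> {}"
  obtains u v where "(u, v) \<in> parcs G" "u \<in> S" "v \<notin> S"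
proof (rule ccontr)
  assume none: "\<not> thesis"
  obtain r v where r: "r \<in> S" "r \<in> pverts G" and v: "v \<in> pverts G" "v \<notin> S"
    using assms by blast
  have "strongly_connected (with_proj G)"
    using symmetric_connected_imp_strongly_connected[OF _ assms(1)] sym_arcs by blast
  then have "r \<rightarrow>\<^sup>*\<^bsub>with_proj G\<^esub> v" using r v by (auto simp: strongly_connected_def)
  then have "v \<in> S"
    by (induction rule: reachable_induct) (use none that r in auto)
  then show False using v by simp
qed

text \<open>A vertex set is grown one vertex at a time along boundary arcs. The arc to the new
  vertex gives an edge not contained in the old set, so \<open>k\<close> vertices can be chosen that
  span at least \<open>k - 1\<close> edges.\<close>

lemma (in pair_graph) connected_card_pverts_le:
  assumes "connected (with_proj G)"
  shows "card (pverts G) \<le> Suc (num_edges G)"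
proof -
  let ?e = "\<lambda>(u, v). {u, v}"
  let ?A = "\<lambda>S. {a \<in> parcs G. fst a \<in> S \<and> snd a \<in> S}"
  have "\<exists>S \<subseteq> pverts G. card S = k \<and> k \<le> Suc (card (?e ` ?A S))" if "k \<le> card (pverts G)" for k
    using that
  proof (induction k)
    case 0
    show ?case by (intro exI[of _ "{}"]) simp
  next
    case (Suc k)
    then obtain S where S: "S \<subseteq> pverts G" "card S = k" "k \<le> Suc (card (?e ` ?A S))" by auto
    have fin: "finite S" using S(1) pair_finite_verts finite_subset by blast
    show ?case
    proof (cases "S = {}")
      case True
      obtain r where "r \<in> pverts G" using Suc.prems by fastforce
      then show ?thesis using S True by (intro exI[of _ "{r}"]) auto
    next
      case False
      moreover have "S \<subset> pverts G" using S Suc.prems by auto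
      ultimately obtain u v where uv: "(u, v) \<in> parcs G" "u \<in> S" "v \<notin> S"
        using connected_boundary_arc[OF assms] by metis
      have finA: "finite (?e ` ?A X)" for X using pair_finite_arcs by simp
      have sub: "E \<subseteq> S" if "E \<in> ?e ` ?A S" for E using that by auto
      have "\<not> {u, v} \<subseteq> S" using uv(3) by simp
      then have "{u, v} \<notin> ?e ` ?A S" by (rule contrapos_nn) (rule sub)
      then have "Suc (card (?e ` ?A S)) = card (insert {u, v} (?e ` ?A S))"
        using finA by simp
      also have "\<dots> \<le> card (?e ` ?A (insert v S))"
      proof (intro card_mono finA)
        have "(u, v) \<in> ?A (insert v S)" using uv by simp
        then have "{u, v} \<in> ?e ` ?A (insert v S)" by (rule rev_image_eqI) simp
        moreover have "?e ` ?A S \<subseteq> ?e ` ?A (insert v S)" by (intro image_mono) auto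
        ultimately show "insert {u, v} (?e ` ?A S) \<subseteq> ?e ` ?A (insert v S)" by simp
      qed
      finally show ?thesis
        using S fin uv in_arcsD2[OF uv(1)] by (intro exI[of _ "insert v S"]) auto
    qed
  qed
  then obtain S where S: "S \<subseteq> pverts G" "card S = card (pverts G)"
    "card (pverts G) \<le> Suc (card (?e ` ?A S))" by blast
  have "card (?e ` ?A S) \<le> num_edges G"
    unfolding num_edges_def using pair_finite_arcs by (intro card_mono) auto
  then show ?thesis using S(3) by simp
qed

section \<open>Degrees and the Laplacian energy\<close>

lemma (in pair_graph) laplacian_spectrum_mset:
  assumes "distinct vs" "set vs = pverts G"
  obtains as where "char_poly (laplacian_matrix G vs) = (\<Prod>a\<leftarrow>as. [:- a, 1:])"
    "length as = length vs" "laplacian_spectrum G = mset as"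
proof -
  have "\<exists>as. char_poly (laplacian_matrix G vs) = (\<Prod>a\<leftarrow>as. [:- a, 1:]) \<and> length as = length vs"
    using parcs_sym
    by (intro symmetric_mat_char_poly_splits laplacian_matrix_carrier)
      (auto simp: laplacian_matrix_index)
  then obtain as where as: "char_poly (laplacian_matrix G vs) = (\<Prod>a\<leftarrow>as. [:- a, 1:])"
    "length as = length vs" by auto
  have "proots (\<Prod>a\<leftarrow>as. [:- a, 1:]) = mset as" for as :: "real list"
    by (induction as)
      (simp_all add: proots_mult prod_list_zero_iff image_iff del: mult_pCons_left)
  then show ?thesis
    using that as laplacian_spectrum_eq[OF pair_finite_verts assms] by metis
qed

text \<open>Without loops the Laplacian has the degrees on its diagonal, so the diagonal inequality
  applies with the average degree as \<open>c\<close>.\<close>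

lemma (in pair_graph) sum_abs_degree_le_laplacian_energy:
  "(\<Sum>v\<in>pverts G. \<bar>real (degree_of G v) - average_degree G\<bar>) \<le> laplacian_energy G"
proof -
  let ?vs = "vertex_enum G" and ?c = "average_degree G"
  note vs = vertex_enum[OF pair_finite_verts]
  let ?L = "laplacian_matrix G ?vs"
  obtain as where as: "char_poly ?L = (\<Prod>a\<leftarrow>as. [:- a, 1:])"
    "length as = length ?vs" "laplacian_spectrum G = mset as"
    using laplacian_spectrum_mset[OF vs] .
  have no_loop: "(v, v) \<notin> parcs G" for v
    using pair_no_loops by fastforce
  have "?L\<^sup>T = ?L"
    using laplacian_matrix_carrier[of G ?vs] parcs_sym
    by (intro eq_matI) (auto simp: laplacian_matrix_index)
  note bound = sum_abs_diag_le_sum_abs_eigenvalues[OF laplacian_matrix_carrier this as(1,2), of ?c]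
  have "(\<Sum>v\<in>pverts G. \<bar>real (degree_of G v) - ?c\<bar>) = (\<Sum>i<length ?vs. \<bar>real (degree_of G (?vs ! i)) - ?c\<bar>)"
    by (rule sum.reindex_bij_betw[OF bij_betw_nth[OF vs(1) refl vs(2)[symmetric]], symmetric])
  also have "\<dots> = (\<Sum>i<length ?vs. \<bar>?L $$ (i, i) - ?c\<bar>)"
    using no_loop by (intro sum.cong) (auto simp: laplacian_matrix_index)
  also have "\<dots> \<le> laplacian_energy G"
    using bound by (simp add: laplacian_energy_def as(3) flip: sum_mset_sum_list)
  finally show ?thesis .
qed

lemma (in pair_graph) connected_laplacian_energy_ge:
  fixes n s :: nat
  assumes conn: "connected (with_proj G)"
    and n: "card (pverts G) = n" "n > 0" and s: "card (non_pendent G) = s"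
  shows "2 * (real n - real s) * (1 - 2 / real n) \<le> laplacian_energy G"
proof -
  let ?c = "average_degree G" and ?d = "\<lambda>v. real (degree_of G v)"
  let ?P = "pverts G - non_pendent G"
  have NP: "non_pendent G \<subseteq> pverts G" by (auto simp: non_pendent_def)
  have fin: "finite (pverts G)" "finite (non_pendent G)"
    using pair_finite_verts NP finite_subset by blast+
  have cardP: "real (card ?P) = real n - real s"
    using card_mono[OF fin(1) NP] NP fin n s by (simp add: card_Diff_subset of_nat_diff)
  have "real n \<le> real (num_edges G) + 1"
    using connected_card_pverts_le[OF conn] n by simp
  then have "2 * (real n - 1) / real n \<le> ?c"
    unfolding average_degree_def n(1) by (intro divide_right_mono) auto
  moreover have "2 * (real n - 1) / real n = 2 - 2 / real n"
    using n(2) by (simp add: field_simps)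
  ultimately have c: "1 - 2 / real n \<le> ?c - 1" by simp
  have sum0: "(\<Sum>v\<in>pverts G. ?d v - ?c) = 0"
    using sum_degree_of n by (simp add: sum_subtractf average_degree_def flip: of_nat_sum)
  have split: "(\<Sum>v\<in>pverts G. f v) = (\<Sum>v\<in>?P. f v) + (\<Sum>v\<in>non_pendent G. f v)" for f :: "'a \<Rightarrow> real"
    using sum.subset_diff[OF NP fin(1)] by blast
  have pendent: "(\<Sum>v\<in>?P. f (?d v)) = (real n - real s) * f 1" for f :: "real \<Rightarrow> real"
  proof -
    have "(\<Sum>v\<in>?P. f (?d v)) = (\<Sum>v\<in>?P. f 1)"
      by (intro sum.cong) (auto simp: non_pendent_def)
    then show ?thesis using cardP by simp
  qed
  have "(real n - real s) * (1 - 2 / real n) \<le> (real n - real s) * (?c - 1)"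
    using c cardP by (intro mult_left_mono) (simp_all flip: cardP)
  then have "2 * (real n - real s) * (1 - 2 / real n) \<le> (real n - real s) * (?c - 1) + (real n - real s) * (?c - 1)"
    by (simp only: mult_2 distrib_right add_mono)
  \<comment> \<open>All deviations cancel, so the surplus of the non-pendent vertices equals the
    deficit \<open>(real n - real s) * (?c - 1)\<close> of the pendent ones. This is the source of
    the factor 2.\<close>
  also have "\<dots> = (\<Sum>v\<in>?P. ?c - ?d v) + (\<Sum>v\<in>non_pendent G. ?d v - ?c)"
    using sum0 unfolding split[of "\<lambda>v. ?d v - ?c"] pendent[of "\<lambda>x. ?c - x"] pendent[of "\<lambda>x. x - ?c"]
    by (simp add: algebra_simps)
  also have "\<dots> \<le> (\<Sum>v\<in>?P. \<bar>?d v - ?c\<bar>) + (\<Sum>v\<in>non_pendent G. \<bar>?d v - ?c\<bar>)"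
    by (intro add_mono sum_mono) auto
  also have "\<dots> = (\<Sum>v\<in>pverts G. \<bar>?d v - ?c\<bar>)" by (rule split[symmetric])
  also have "\<dots> \<le> laplacian_energy G" by (rule sum_abs_degree_le_laplacian_energy)
  finally show ?thesis .
qed

text \<open>If every degree were 1, the handshake lemma would give n = 2m, which together with n
  \<le> m + 1 forces n \<le> 2.\<close>

lemma (in pair_graph) connected_non_pendent_nonempty:
  assumes "connected (with_proj G)" "card (pverts G) \<ge> 3"
  shows "non_pendent G \<noteq> {}"
proof
  assume "non_pendent G = {}"
  then have "(\<Sum>v\<in>pverts G. degree_of G v) = (\<Sum>v\<in>pverts G. 1)"
    by (intro sum.cong) (auto simp: non_pendent_def)
  then show False
    using sum_degree_of connected_card_pverts_le[OF assms(1)] assms(2) by simp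
qed

section \<open>The path\<close>

lemma pair_graph_path_graph: "pair_graph (path_graph n)"
proof -
  have "parcs (path_graph n) \<subseteq> {..<n} \<times> {..<n}" by (auto simp: path_graph_def)
  then have "finite (parcs (path_graph n))" using finite_subset by blast
  then show ?thesis
    by unfold_locales (auto simp: path_graph_def symmetric_def intro!: symI)
qed

lemma num_edges_path_graph: "num_edges (path_graph n) = n - 1"
proof -
  have "(\<lambda>(u, v). {u, v}) ` parcs (path_graph n) = (\<lambda>i. {i, Suc i}) ` {..<n - 1}"
  proof (intro equalityI subsetI)
    fix E assume "E \<in> (\<lambda>i. {i, Suc i}) ` {..<n - 1}"
    then obtain i where "i < n - 1" "E = {i, Suc i}" by auto
    then show "E \<in> (\<lambda>(u, v). {u, v}) ` parcs (path_graph n)"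
      by (intro image_eqI[of _ _ "(i, Suc i)"]) (auto simp: path_graph_def)
  qed (auto simp: path_graph_def)
  moreover have "inj_on (\<lambda>i. {i, Suc i}) {..<n - 1}"
    by (auto simp: inj_on_def doubleton_eq_iff)
  ultimately show ?thesis by (simp add: num_edges_def card_image)
qed

lemma sum_path_neighbours:
  fixes f :: "nat \<Rightarrow> real"
  assumes "i < n"
  shows "(\<Sum>j<n. if j = Suc i \<or> i = Suc j then f j else 0) =
    (if Suc i < n then f (Suc i) else 0) + (if i = 0 then 0 else f (i - 1))"
proof -
  \<comment> \<open>At \<open>i = 0\<close> the truncated \<open>i - 1\<close> is 0, and the inner
    conditional removes this spurious neighbour.\<close>
  have "(\<Sum>j<n. if j = Suc i \<or> i = Suc j then f j else 0) =
      (\<Sum>j<n. (if j = Suc i then f j else 0) + (if j = i - 1 then if i = 0 then 0 else f j else 0))"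
    by (intro sum.cong refl) auto
  then show ?thesis using assms by (simp add: sum.distrib)
qed

lemma degree_of_path_graph:
  assumes "i < n"
  shows "real (degree_of (path_graph n) i) = (if Suc i < n then 1 else 0) + (if i = 0 then 0 else 1)"
proof -
  have "{e \<in> parcs (path_graph n). fst e = i} = Pair i ` {j \<in> {..<n}. j = Suc i \<or> i = Suc j}"
    using assms by (auto simp: path_graph_def)
  then have "card {e \<in> parcs (path_graph n). fst e = i} = card (Pair i ` {j \<in> {..<n}. j = Suc i \<or> i = Suc j})"
    by simp
  also have "\<dots> = card {j \<in> {..<n}. j = Suc i \<or> i = Suc j}"
    by (intro card_image) (simp add: inj_on_def)
  also have "real \<dots> = (\<Sum>j<n. if j = Suc i \<or> i = Suc j then 1 else 0)"
    by (simp add: sum.If_cases Int_def)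
  finally show ?thesis using sum_path_neighbours[OF assms, of "\<lambda>_. 1"] by (simp add: degree_of_eq)
qed

text \<open>
  The eigenvector \<open>v i = cos ((i + 1/2) \<theta>)\<close> extends to the discrete line so that \<open>v (-1) = v 0\<close> and
  \<open>v n = v (n - 1)\<close>; hence the two end vertices satisfy the same recurrence as the inner ones.
\<close>

lemma path_laplacian_root:
  assumes "j < n"
  shows "poly (char_poly (laplacian_matrix (path_graph n) [0..<n])) (2 - 2 * cos (pi * real j / real n)) = 0"
proof -
  let ?G = "path_graph n" and ?L = "laplacian_matrix (path_graph n) [0..<n]"
  define \<theta> where "\<theta> = pi * real j / real n"
  define v where "v i = cos ((real i + 1/2) * \<theta>)" for i
  have L: "?L \<in> carrier_mat n n" using laplacian_matrix_carrier[of ?G "[0..<n]"] by simp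
  have end0: "cos ((0 - 1/2) * \<theta>) = v 0"
    by (simp add: v_def)
  have n\<theta>: "real n * \<theta> = pi * real j" using assms by (simp add: \<theta>_def)
  \<comment> \<open>The two sides differ by a multiple of sin (n \<theta>) = sin (\<pi> j) =
    0.\<close>
  have end1: "cos ((real n - 1/2) * \<theta>) = cos ((real n + 1/2) * \<theta>)"
    using sin_npi2[of j] by (simp add: ring_distribs n\<theta> cos_add cos_diff)
  have rec: "2 * v i - cos ((real i - 1/2) * \<theta>) - cos ((real i + 3/2) * \<theta>) = (2 - 2 * cos \<theta>) * v i" for i
  proof -
    have "cos ((real i - 1/2) * \<theta>) + cos ((real i + 3/2) * \<theta>) =
        cos ((real i + 1/2) * \<theta> - \<theta>) + cos ((real i + 1/2) * \<theta> + \<theta>)"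
      by (simp add: algebra_simps add_divide_distrib)
    also have "\<dots> = 2 * cos \<theta> * v i"
      unfolding v_def by (simp add: cos_add cos_diff)
    finally show ?thesis by (simp add: algebra_simps)
  qed
  have "?L *\<^sub>v vec n v = (2 - 2 * cos \<theta>) \<cdot>\<^sub>v vec n v"
  proof (rule eq_vecI)
    fix i assume "i < dim_vec ((2 - 2 * cos \<theta>) \<cdot>\<^sub>v vec n v)"
    then have i: "i < n" by simp
    have "(?L *\<^sub>v vec n v) $ i = (\<Sum>k<n. ?L $$ (i, k) * v k)"
      using i L by (simp add: scalar_prod_def atLeast0LessThan)
    also have "\<dots> = (\<Sum>k<n. (if k = i then real (degree_of ?G i) * v i else 0)
        - (if k = Suc i \<or> i = Suc k then v k else 0))"
      using i by (intro sum.cong refl) (auto simp: laplacian_matrix_index path_graph_def left_diff_distrib)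
    also have "\<dots> = real (degree_of ?G i) * v i -
        ((if Suc i < n then v (Suc i) else 0) + (if i = 0 then 0 else v (i - 1)))"
      unfolding sum_subtractf sum_path_neighbours[OF i] using i by simp
    \<comment> \<open>Each absent neighbour lowers the degree by one; adding and subtracting
      \<open>v i\<close> balances this.\<close>
    also have "\<dots> = 2 * v i - (if i = 0 then v 0 else v (i - 1)) - (if Suc i < n then v (Suc i) else v (n - 1))"
      using i unfolding degree_of_path_graph[OF i] by (auto simp: algebra_simps dest: less_antisym)
    also have "(if i = 0 then v 0 else v (i - 1)) = cos ((real i - 1/2) * \<theta>)"
      using end0 by (auto simp: v_def of_nat_diff algebra_simps)
    also have "(if Suc i < n then v (Suc i) else v (n - 1)) = cos ((real i + 3/2) * \<theta>)"
    proof (cases "Suc i < n")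
      case False
      then have "n = Suc i" using i by simp
      then show ?thesis using end1 by (simp add: v_def algebra_simps)
    qed (simp add: v_def algebra_simps)
    finally show "(?L *\<^sub>v vec n v) $ i = ((2 - 2 * cos \<theta>) \<cdot>\<^sub>v vec n v) $ i"
      using rec i by simp
  qed (use L in auto)
  \<comment> \<open>\<open>v 0\<close> is \<open>cos (\<theta> / 2)\<close>, which is positive
    because 0 \<le> \<theta> < \<pi>.\<close>
  moreover have "vec n v \<noteq> 0\<^sub>v n"
  proof
    assume "vec n v = 0\<^sub>v n"
    then have "v 0 = 0" using assms by (metis index_vec index_zero_vec(1) less_nat_zero_code not_gr_zero)
    moreover have "\<theta> < pi" using assms by (simp add: \<theta>_def field_simps)
    moreover have "0 \<le> \<theta>" by (simp add: \<theta>_def)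
    ultimately show False using cos_gt_zero_pi[of "\<theta> / 2"] pi_gt_zero by (simp add: v_def)
  qed
  ultimately have "eigenvalue ?L (2 - 2 * cos \<theta>)"
    using L unfolding eigenvalue_def eigenvector_def by (intro exI[of _ "vec n v"]) auto
  then show ?thesis using eigenvalue_root_char_poly[OF L] by (simp add: \<theta>_def)
qed

text \<open>Cosine is injective on [0, \<pi>], so the \<open>n\<close> roots found are distinct. The
  characteristic polynomial has \<open>n\<close> real roots with multiplicity, so there are no
  others and all are simple.\<close>

lemma laplacian_spectrum_path_graph:
  "laplacian_spectrum (path_graph n) = image_mset (\<lambda>j. 2 - 2 * cos (pi * real j / real n)) (mset_set {..<n})"
proof -
  interpret pair_graph "path_graph n" by (rule pair_graph_path_graph)
  let ?f = "\<lambda>j. 2 - 2 * cos (pi * real j / real n)"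
  let ?p = "char_poly (laplacian_matrix (path_graph n) [0..<n])"
  have pverts: "pverts (path_graph n) = {..<n}" by (simp add: path_graph_def)
  have spec: "laplacian_spectrum (path_graph n) = proots ?p"
    by (rule laplacian_spectrum_eq) (auto simp: pverts)
  have "?p \<noteq> 0"
    using laplacian_matrix_carrier[of "path_graph n" "[0..<n]"]
    by (metis degree_monic_char_poly leading_coeff_0_iff zero_neq_one)
  have le: "pi * real j / real n \<le> pi" if "j < n" for j
    using that by (simp add: divide_le_eq)
  have inj: "inj_on ?f {..<n}"
  proof (rule inj_onI)
    fix i j assume ij: "i \<in> {..<n}" "j \<in> {..<n}" "?f i = ?f j"
    have "pi * real i / real n = pi * real j / real n"
      by (rule cos_inj_pi) (use ij le in auto)
    then show "i = j" using ij by simp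
  qed
  have "mset_set (?f ` {..<n}) \<subseteq># proots ?p"
  proof (rule mset_subset_eqI)
    fix x
    show "count (mset_set (?f ` {..<n})) x \<le> count (proots ?p) x"
      using path_laplacian_root[of _ n] \<open>?p \<noteq> 0\<close>
      by (cases "x \<in> ?f ` {..<n}") (auto simp: Suc_le_eq order_root)
  qed
  moreover have "size (proots ?p) = n"
    using size_laplacian_spectrum[OF pair_graph_path_graph, of n] by (simp add: spec pverts)
  moreover have "size (mset_set (?f ` {..<n})) = n"
    using card_image[OF inj] by simp
  ultimately have "mset_set (?f ` {..<n}) = proots ?p"
    using mset_subset_size by (metis nless_le subset_mset.less_le)
  then show ?thesis using inj by (simp add: spec image_mset_mset_set)
qed

lemma laplacian_energy_path_graph:
  assumes "n > 0"
  shows "laplacian_energy (path_graph n) = (\<Sum>j<n. \<bar>2 * cos (pi * real j / real n) - 2 / real n\<bar>)"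
proof -
  have "average_degree (path_graph n) = 2 - 2 / real n"
    using assms by (simp add: average_degree_def num_edges_path_graph) (simp add: path_graph_def of_nat_diff field_simps)
  then show ?thesis
    unfolding laplacian_energy_def laplacian_spectrum_path_graph
    by (simp add: multiset.map_comp o_def flip: sum_unfold_sum_mset)
      (simp add: abs_minus_commute)
qed

section \<open>Trigonometric sums and estimates\<close>

text \<open>Each product \<open>2 * cos (real j * \<theta>) * sin (\<theta> / 2)\<close> is the
  difference of the sines of (j + 1/2) \<theta> and (j - 1/2) \<theta>.\<close>

lemma sum_cos_telescope:
  fixes \<theta> :: real
  shows "(\<Sum>j<k. 2 * cos (real j * \<theta>)) * sin (\<theta> / 2) = sin ((real k - 1/2) * \<theta>) + sin (\<theta> / 2)"
proof (induction k)
  case (Suc k)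
  have "(real (Suc k) - 1/2) * \<theta> = real k * \<theta> + \<theta> / 2" "(real k - 1/2) * \<theta> = real k * \<theta> - \<theta> / 2"
    by (simp_all add: field_simps)
  then show ?case using Suc by (simp only: sum.lessThan_Suc distrib_right sin_add sin_diff)
qed simp

lemma sin_ge_cubic:
  fixes x :: real
  assumes "0 \<le> x"
  shows "x - x ^ 3 / 6 \<le> sin x"
proof -
  have "\<bar>sin x - x\<bar> \<le> \<bar>x\<bar> ^ 3 / 6"
    using Maclaurin_sin_bound[of x 3] by (simp add: eval_nat_numeral sin_coeff_def)
  then have "\<bar>sin x - x\<bar> \<le> x ^ 3 / 6" using assms by simp
  then show ?thesis by linarith
qed

text \<open>Otherwise 1/2 = sin (\<pi> / 6) would be at most sin (25/48), which the Taylor bound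
  with error x^5 / 120 puts below 1/2. The value 25/8 bounds 4 / \<pi> by 32/25 = 2 (1 - 9/25),
  matching the coefficient in case (viii).\<close>

lemma pi_ge_25_8: "25 / 8 \<le> pi"
proof (rule ccontr)
  let ?x = "25 / 48 :: real"
  assume "\<not> 25 / 8 \<le> pi"
  then have "sin (pi / 6) \<le> sin ?x"
    using pi_ge_two by (intro sin_monotone_2pi_le) auto
  moreover have "\<bar>sin ?x - (?x - ?x ^ 3 / 6)\<bar> \<le> ?x ^ 5 / 120"
    using Maclaurin_sin_bound[of ?x 5] by (simp add: lessThan_nat_numeral sin_coeff_def fact_numeral)
  ultimately show False by (simp add: sin_30 power_divide abs_le_iff)
qed

text \<open>This settles the sign of the first half of the summands in the energy of the path. With
  x = \<pi> / (2n) the angle is at most \<pi>/2 - x, so the cosine is at least sin x, while 1/n is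
  only 2x / \<pi>.\<close>

lemma cos_path_ge:
  assumes "n \<ge> 2" "2 * j < n"
  shows "1 / real n \<le> cos (pi * real j / real n)"
proof -
  define x where "x = pi / (2 * real n)"
  have x: "0 < x" "x \<le> 1" using assms(1) pi_less_4 by (simp_all add: x_def field_simps)
  have n: "1 / real n = 2 * x / pi" by (simp add: x_def)
  \<comment> \<open>Integrality turns \<open>2 * j < n\<close> into
    \<open>2 * j + 1 \<le> n\<close>, which yields the gap \<open>x\<close> below \<pi>/2.\<close>
  have "pi * (2 * real j + 1) \<le> pi * real n"
    using assms(2) by (intro mult_left_mono) auto
  then have le: "pi * real j / real n \<le> pi / 2 - x"
    using assms(1) by (simp add: x_def field_simps)
  \<comment> \<open>The factor 5/6 separates the two sides: 2 / \<pi> \<le> 16/25, and x \<le> 1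
    gives x^3 / 6 \<le> x / 6.\<close>
  have "2 * x / pi \<le> x * (5 / 6)"
    using x pi_ge_25_8 by (simp add: field_simps)
  also have "\<dots> \<le> x - x ^ 3 / 6"
    using x mult_left_le[of "x\<^sup>2" x] power_le_one[of x 2] by (simp add: power2_eq_square power3_eq_cube)
  also have "\<dots> \<le> sin x" using x by (intro sin_ge_cubic) simp
  also have "\<dots> = cos (pi / 2 - x)" by (simp add: cos_diff)
  also have "\<dots> \<le> cos (pi * real j / real n)"
    using le x pi_ge_two by (intro cos_monotone_0_pi_le) auto
  finally show ?thesis by (simp add: n)
qed

text \<open>The deviations \<open>?y j\<close> sum to zero, are nonnegative for \<open>j < k\<close>
  and nonpositive from \<open>k\<close> on. The energy is therefore twice the sum of the first
  \<open>k\<close>, which telescopes.\<close>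

lemma laplacian_energy_path_graph_le:
  assumes "n \<ge> 2"
  shows "laplacian_energy (path_graph n) \<le> 4 * real n / pi + pi / real n"
proof -
  define \<theta> where "\<theta> = pi / real n"
  define x where "x = \<theta> / 2"
  let ?y = "\<lambda>j. 2 * cos (real j * \<theta>) - 2 / real n"
  \<comment> \<open>The number of indices \<open>j\<close> with \<open>2 * j < n\<close>.\<close>
  define k where "k = (n + 1) div 2"
  have k: "k \<le> n" "n \<le> 2 * k" using assms by (auto simp: k_def)
  have x: "0 < x" "x \<le> 1" using assms pi_less_4 by (simp_all add: x_def \<theta>_def field_simps)
  have sin: "0 < sin x" using x pi_ge_two by (intro sin_gt_zero) auto
  have sum: "(\<Sum>j<m. ?y j) = (sin ((real m - 1/2) * \<theta>) + sin x) / sin x - 2 * real m / real n" for m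
  proof -
    have "(\<Sum>j<m. 2 * cos (real j * \<theta>)) = (sin ((real m - 1/2) * \<theta>) + sin x) / sin x"
      using sum_cos_telescope[of \<theta> m] sin unfolding x_def by (subst nonzero_eq_divide_eq) simp_all
    then show ?thesis by (simp add: sum_subtractf)
  qed
  \<comment> \<open>At \<open>m = n\<close> the boundary sine is thus \<open>sin x\<close>, so the
    quotient equals 2 and cancels against \<open>2 * real n / real n\<close>.\<close>
  have "(real n - 1/2) * \<theta> = pi - x" using assms by (simp add: x_def \<theta>_def field_simps)
  then have sum0: "(\<Sum>j<n. ?y j) = 0" using assms sin by (simp add: sum)
  have split: "(\<Sum>j<n. f j) = (\<Sum>j<k. f j) + (\<Sum>j\<in>{k..<n}. f j)" for f :: "nat \<Rightarrow> real"
    using k by (simp add: sum.atLeastLessThan_concat flip: atLeast0LessThan)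
  have pos: "0 \<le> ?y j" if "j < k" for j
  proof -
    have "2 * j < n" using that by (simp add: k_def)
    from cos_path_ge[OF assms this] show ?thesis by (simp add: \<theta>_def mult.commute)
  qed
  have neg: "?y j \<le> 0" if "j \<in> {k..<n}" for j
  proof -
    have "cos (real j * \<theta>) \<le> cos (pi / 2)"
      using that k by (intro cos_monotone_0_pi_le) (auto simp: \<theta>_def field_simps)
    moreover have "0 \<le> 2 / real n" by simp
    ultimately show ?thesis unfolding cos_pi_half by linarith
  qed
  have "laplacian_energy (path_graph n) = (\<Sum>j<n. \<bar>?y j\<bar>)"
    using assms by (simp add: laplacian_energy_path_graph \<theta>_def mult.commute)
  also have "\<dots> = (\<Sum>j<k. ?y j) - (\<Sum>j\<in>{k..<n}. ?y j)"
    unfolding split[of "\<lambda>j. \<bar>?y j\<bar>"] using pos neg by (simp add: abs_of_nonpos flip: sum_negf)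
  also have "\<dots> = 2 * (\<Sum>j<k. ?y j)"
    using sum0 unfolding split[of ?y] by simp
  \<comment> \<open>The summand 1 coming from \<open>sin x / sin x\<close> is absorbed by
    \<open>2 * real k / real n\<close>, and the remaining sine is at most 1.\<close>
  also have "\<dots> \<le> 2 * (1 / sin x)"
  proof -
    have "sin ((real k - 1/2) * \<theta>) / sin x \<le> 1 / sin x"
      using sin by (intro divide_right_mono) auto
    moreover have "1 \<le> 2 * real k / real n" using k assms by (simp add: field_simps)
    ultimately show ?thesis unfolding sum using sin by (simp add: add_divide_distrib)
  qed
  \<comment> \<open>After clearing denominators this is x \<le> sin x (1 + x^2); the cubic bound
    leaves the slack x^3 (5 - x^2) / 6.\<close>
  also have "1 / sin x \<le> 1 / x + x"
  proof -
    have "0 \<le> x ^ 3 * (5 - x\<^sup>2)" using x power_le_one[of x 2] by simp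
    then have "x \<le> (x - x ^ 3 / 6) * (1 + x\<^sup>2)"
      by (simp add: field_simps power2_eq_square power3_eq_cube)
    also have "\<dots> \<le> sin x * (1 + x\<^sup>2)"
      using x by (intro mult_right_mono sin_ge_cubic) auto
    finally show ?thesis using x sin by (simp add: field_simps power2_eq_square)
  qed
  also have "2 * (1 / x + x) = 4 * real n / pi + pi / real n"
    by (simp add: x_def \<theta>_def field_simps)
  finally show ?thesis by simp
qed

section \<open>Comparison\<close>

theorem corollary3p5:
  fixes T :: "'a pair_pre_digraph" and n s :: nat
  assumes "is_tree T"
    and "card (pverts T) = n" and "n \<ge> 4"
    and "card (non_pendent T) = s"
    and "s = 1 \<and> n \<ge> 9
       \<or> s = 2 \<and> n \<ge> 12
       \<or> s = 3 \<and> n \<ge> 14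
       \<or> s = 4 \<and> n \<ge> 17
       \<or> s = 5 \<and> n \<ge> 20
       \<or> s = 6 \<and> n \<ge> 23
       \<or> s = 7 \<and> n \<ge> 25
       \<or> real s \<le> 9 * real n / 25 - 2"
  shows "laplacian_energy T \<ge> laplacian_energy (path_graph n)"
proof -
  have pg: "pair_graph T" and conn: "connected (with_proj T)"
    using assms(1) by (auto simp: is_tree_def)
  interpret pair_graph T by (rule pg)
  have n: "real n \<ge> 4" using assms(3) by simp
  \<comment> \<open>In (i)-(vii) the lower bound on \<open>n\<close> is the least integer that is at
    least 25 (s + 2) / 9.\<close>
  have bound: "real s \<le> 9 * real n / 25 - 2" using assms(5) by auto
  have "finite (non_pendent T)"
    by (rule finite_subset[OF _ pair_finite_verts]) (auto simp: non_pendent_def)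
  then have s: "real s \<ge> 1"
    using connected_non_pendent_nonempty[OF conn] assms(2-4) by (auto simp: Suc_le_eq card_gt_0_iff)
  have "laplacian_energy (path_graph n) \<le> 4 * real n / pi + pi / real n"
    using assms(3) by (intro laplacian_energy_path_graph_le) simp
  also have "\<dots> \<le> 4 * real n / (25 / 8) + 4 / real n"
    using pi_ge_25_8 pi_less_4 by (intro add_mono divide_left_mono divide_right_mono) auto
  \<comment> \<open>The right side is the lower bound for the tree, expanded. The linear parts
    compare because \<open>bound\<close> gives n - s - 2 \<ge> 16n/25, and the existence of a
    non-pendent vertex pays for the term 4/n.\<close>
  also have "\<dots> \<le> 2 * (real n - real s - 2) + 4 * (real s / real n)"
  proof (rule add_mono)
    show "4 * real n / (25 / 8) \<le> 2 * (real n - real s - 2)" using bound by simp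
    show "4 / real n \<le> 4 * (real s / real n)" using s n by (simp add: divide_right_mono)
  qed
  also have "\<dots> = 2 * (real n - real s) * (1 - 2 / real n)"
    using n by (simp add: field_simps)
  also have "\<dots> \<le> laplacian_energy T"
    using assms(2-4) by (intro connected_laplacian_energy_ge[OF conn]) auto
  finally show ?thesis .
qed

end
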